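(* If $n$ is sufficiently large in terms of $m$, then \[\mathcal{P}_{m,n}^+= m+O(m^{3/4}\log^{1/4} m),\] where the implicit constant is absolute.
   Context: Let $\mathcal{S}_{m,n}$ be the set of words over the alphabet $[n]=\{1,\dots,n\}$ in which each symbol appears exactly $m$ times (a deck of $mn$ cards, $m$ copies of each of $n$ card types). A deck order $\pi\sim\mathcal{S}_{m,n}$ is chosen uniformly at random. In the partial feedback model a guesser makes guesses $g_1,\dots,g_{mn}\in[n]$ sequentially, where $g_t$ is a guess for $\pi_t$; after each guess $g_t$, the guesser is told only whether the guess was correct, i.e. the bit $y_t=1$ if $\pi_t=g_t$ and $y_t=0$ otherwise. A strategy $\mathcal{G}$ chooses each $g_t$ as a function of $(g_1,\dots,g_{t-1},y_1,\dots,y_{t-1})$. Let $P(\mathcal{G},\pi)$ be the number of correct guesses, and $\mathcal{P}^+_{m,n}=\max_{\mathcal{G}}\mathbb{E}[P(\mathcal{G},\pi)]$ over all strategies. $\log$ is the natural logarithm.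
   Formalization: The formal statement assumes m ≥ 2; at m = 1 the error term vanishes since log 1 = 0, and the claim would read P⁺_{1,n} = 1, which is false for every n ≥ 2 (for n = 2 the value is 3/2). *)

theory Defs
  imports Complex_Main
begin

definition decks :: "nat \<Rightarrow> nat \<Rightarrow> nat list set" where
  "decks m n = {\<pi>. length \<pi> = m * n \<and> set \<pi> \<subseteq> {1..n} \<and> (\<forall>i\<in>{1..n}. count_list \<pi> i = m)}"

text \<open>A (partial feedback) strategy maps the history of past guesses and
  correctness bits (g_1,y_1),...,(g_{t-1},y_{t-1}) to the next guess.\<close>
type_synonym strategy = "(nat \<times> bool) list \<Rightarrow> nat"

definition strategies :: "nat \<Rightarrow> strategy set" where
  "strategies n = {G. \<forall>h. G h \<in> {1..n}}"

fun play :: "strategy \<Rightarrow> (nat \<times> bool) list \<Rightarrow> nat list \<Rightarrow> nat" where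
  "play G h [] = 0"
| "play G h (c # cs) =
     (let x = G h; b = (x = c) in (if b then 1 else 0) + play G (h @ [(x, b)]) cs)"

definition score :: "strategy \<Rightarrow> nat list \<Rightarrow> nat" where
  "score G \<pi> = play G [] \<pi>"

definition expected_score :: "nat \<Rightarrow> nat \<Rightarrow> strategy \<Rightarrow> real" where
  "expected_score m n G = (\<Sum>\<pi>\<in>decks m n. real (score G \<pi>)) / real (card (decks m n))"

text \<open>Optimal expected score P^+_{m,n} (the supremum is attained, being over a
  bounded set with finitely many values).\<close>
definition P_plus :: "nat \<Rightarrow> nat \<Rightarrow> real" where
  "P_plus m n = (SUP G\<in>strategies n. expected_score m n G)"

end

(* Conditionally on the feedback, exchanging the next card with an earlier wrongly guessed one shows
   that type x, guessed a times with s successes, comes next with probability at most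
   (m - s) / (mn - a - c), where c is the number of correct guesses of other types. Up to c, this is
   a bandit whose arms all start at success rate 1/n, so by the Gittins index argument the optimum
   is at most the number mn of rounds times the index of a fresh arm. The index is bounded by
   (1 + O(m^(-1/4)))/n by means of an explicit excessive function V(a, s) >= 0 with V(0, 0) = 0:
   m times a Huber function of the deficit a/(mn) - s/m, plus a small drift, and the trivial m - s
   once a type has been guessed almost mn times. An exponential supermartingale makes the event that
   c is of order n negligible as n tends to infinity. Guessing a constant scores exactly m. *)

theory Submission
  imports Defs "HOL-Library.Multiset" "HOL-Real_Asymp.Real_Asymp"
begin

section \<open>Decks consistent with a history\<close>

text \<open>A uniform deck conditioned on the feedback is uniform on this set, so conditional
  probabilities become quotients of cardinalities.\<close>

definition consistent_decks :: "nat \<Rightarrow> nat \<Rightarrow> (nat \<times> bool) list \<Rightarrow> nat list set" where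
  "consistent_decks m n h =
     {\<pi> \<in> decks m n. \<forall>k<length h. (fst (h ! k) = \<pi> ! k) = snd (h ! k)}"

definition guesses :: "nat \<Rightarrow> (nat \<times> bool) list \<Rightarrow> nat" where
  "guesses i h = count_list (map fst h) i"

definition hits :: "nat \<Rightarrow> (nat \<times> bool) list \<Rightarrow> nat" where
  "hits i h = count_list h (i, True)"

lemma finite_decks: "finite (decks m n)"
  by (rule finite_subset[OF _ finite_lists_length_eq[of "{1..n}" "m * n"]]) (auto simp: decks_def)

lemma finite_consistent_decks: "finite (consistent_decks m n h)"
  by (simp add: consistent_decks_def finite_decks)

lemma consistent_decks_Nil: "consistent_decks m n [] = decks m n"
  by (simp add: consistent_decks_def)

lemma length_decks: "\<pi> \<in> decks m n \<Longrightarrow> length \<pi> = m * n"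
  by (simp add: decks_def)

lemma decks_nonempty: "decks m n \<noteq> {}"
proof -
  define \<pi> where "\<pi> = concat (map (replicate m) [1..<Suc n])"
  have len: "length \<pi> = m * n"
    by (simp add: \<pi>_def length_concat o_def sum_list_triv)
  have "count_list \<pi> i = m" if "i \<in> {1..n}" for i
  proof -
    have "count_list \<pi> i = (\<Sum>j\<leftarrow>[1..<Suc n]. if j = i then m else 0)"
      unfolding \<pi>_def count_list_concat map_map o_def
      by (intro arg_cong[where f = sum_list] map_cong)
         (auto simp: count_list_eq_length_filter)
    also have "\<dots> = (\<Sum>j\<in>{1..<Suc n}. if j = i then m else 0)"
      by (subst sum_list_distinct_conv_sum_set) auto
    also have "\<dots> = m" using that by simp
    finally show ?thesis .
  qed
  with len have "\<pi> \<in> decks m n"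
    by (auto simp: decks_def \<pi>_def)
  then show ?thesis by blast
qed

lemma count_list_conv_card: "count_list xs x = card {k. k < length xs \<and> xs ! k = x}"
  by (simp add: count_list_eq_length_filter length_filter_conv_card eq_commute)

lemma decks_swap:
  assumes "\<pi> \<in> decks m n" "i < m * n" "j < m * n"
  shows "\<pi>[i := \<pi> ! j, j := \<pi> ! i] \<in> decks m n"
proof -
  let ?\<sigma> = "\<pi>[i := \<pi> ! j, j := \<pi> ! i]"
  have ms: "mset ?\<sigma> = mset \<pi>"
    using assms by (subst mset_swap) (auto simp: length_decks)
  have "count_list ?\<sigma> x = count_list \<pi> x" for x
    using ms by (metis count_mset count_list_eq_length_filter)
  moreover have "set ?\<sigma> = set \<pi>" using ms by (rule mset_eq_setD)
  ultimately show ?thesis using assms(1) by (simp add: decks_def)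
qed

section \<open>Conditional probability of a correct guess\<close>

lemma consistent_decks_snoc:
  assumes "length h < m * n"
  shows "consistent_decks m n (h @ [(x, b)]) =
    {\<pi> \<in> consistent_decks m n h. (\<pi> ! length h = x) = b}"
  by (auto simp: consistent_decks_def nth_append less_Suc_eq all_conj_distrib)

text \<open>A past position holding \<open>x\<close> is either a recorded hit on \<open>x\<close> or
  a wrong guess of another type. Wrong guesses of \<open>x\<close> and hits on other types exclude
  \<open>x\<close>.\<close>

lemma card_positions_hit:
  assumes \<pi>: "\<pi> \<in> consistent_decks m n h" and h: "length h \<le> m * n" and x: "x \<in> {1..n}"
  shows "card {p. p < m * n \<and> (p < length h \<longrightarrow> fst (h ! p) \<noteq> x \<and> \<not> snd (h ! p)) \<and> \<pi> ! p = x}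
      + hits x h = m" (is "card ?B + _ = m")
proof -
  have d: "\<pi> \<in> decks m n" and c: "\<And>k. k < length h \<Longrightarrow> (fst (h ! k) = \<pi> ! k) = snd (h ! k)"
    using \<pi> by (auto simp: consistent_decks_def)
  let ?C = "{k. k < length h \<and> h ! k = (x, True)}"
  have "{k. k < m * n \<and> \<pi> ! k = x} = ?B \<union> ?C"
    using h c by (fastforce simp: prod_eq_iff)
  moreover have "?B \<inter> ?C = {}" by auto
  ultimately have "card {k. k < m * n \<and> \<pi> ! k = x} = card ?B + card ?C"
    by (simp add: card_Un_disjoint)
  moreover have "card {k. k < m * n \<and> \<pi> ! k = x} = m"
    using d x by (auto simp: decks_def count_list_conv_card)
  ultimately show ?thesis
    by (simp add: hits_def count_list_conv_card)
qed

text \<open>Exchanging the next card with a card at a position not yet ruled out for type \<open>x\<close>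
  preserves the history, so among all such positions the next one is the least likely to hold \<open>x\<close>.\<close>
lemma card_hit_le_swap:
  assumes h: "length h < m * n" and p: "p < m * n"
    and np: "p < length h \<Longrightarrow> fst (h ! p) \<noteq> x \<and> \<not> snd (h ! p)"
  shows "card (consistent_decks m n (h @ [(x, True)]))
    \<le> card {\<pi> \<in> consistent_decks m n h. \<pi> ! p = x}"
proof (rule card_inj_on_le)
  let ?t = "length h"
  let ?f = "\<lambda>\<pi>::nat list. \<pi>[p := \<pi> ! ?t, ?t := \<pi> ! p]"
  have len: "length \<pi> = m * n" if "\<pi> \<in> consistent_decks m n g" for \<pi> g
    using that by (auto simp: consistent_decks_def length_decks)
  have inv: "?f (?f \<pi>) = \<pi>" if "length \<pi> = m * n" for \<pi>
    using that h p by (intro nth_equalityI) (auto simp: nth_list_update)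
  show "inj_on ?f (consistent_decks m n (h @ [(x, True)]))"
    by (rule inj_on_inverseI[where g = ?f]) (rule inv, erule len)
  show "?f ` consistent_decks m n (h @ [(x, True)]) \<subseteq> {\<pi> \<in> consistent_decks m n h. \<pi> ! p = x}"
  proof (intro image_subsetI)
    fix \<pi> assume "\<pi> \<in> consistent_decks m n (h @ [(x, True)])"
    then have \<pi>: "\<pi> \<in> consistent_decks m n h" and x: "\<pi> ! ?t = x"
      by (auto simp: consistent_decks_snoc[OF h])
    then have d: "\<pi> \<in> decks m n"
      and c: "\<And>k. k < ?t \<Longrightarrow> (fst (h ! k) = \<pi> ! k) = snd (h ! k)"
      by (auto simp: consistent_decks_def)
    \<comment> \<open>The only past position that can change is \<open>p\<close>. Its guess was
      wrong and differs from \<open>x\<close>, so it stays wrong once \<open>x\<close> is moved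
      there.\<close>
    have "(fst (h ! k) = ?f \<pi> ! k) = snd (h ! k)" if k: "k < ?t" for k
      using c[OF k] k np x p h length_decks[OF d] by (cases "k = p") (auto simp: nth_list_update)
    moreover have "?f \<pi> \<in> decks m n" using decks_swap[OF d p h] .
    moreover have "?f \<pi> ! p = x"
      using x p h length_decks[OF d] by (cases "p = ?t") (auto simp: nth_list_update)
    ultimately show "?f \<pi> \<in> {\<pi> \<in> consistent_decks m n h. \<pi> ! p = x}"
      by (simp add: consistent_decks_def)
  qed
qed (simp add: finite_consistent_decks)

text \<open>Each excluded position is charged to a guess of \<open>x\<close> or to a hit on another
  type; the range hypothesis makes that type occur in the sum.\<close>

lemma card_ruled_out_le:
  assumes "\<And>e. e \<in> set h \<Longrightarrow> fst e \<in> {1..n}"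
  shows "card {k. k < length h \<and> (fst (h ! k) = x \<or> snd (h ! k))}
    \<le> guesses x h + (\<Sum>j\<in>{1..n} - {x}. hits j h)"
proof -
  have "length (filter (\<lambda>e. fst e = x \<or> snd e) h) \<le> guesses x h + (\<Sum>j\<in>{1..n} - {x}. hits j h)"
    using assms
  proof (induction h)
    case Nil
    show ?case by simp
  next
    case (Cons e h)
    have IH: "length (filter (\<lambda>e. fst e = x \<or> snd e) h)
        \<le> guesses x h + (\<Sum>j\<in>{1..n} - {x}. hits j h)"
      using Cons by auto
    have H: "hits j (e # h) = hits j h + (if e = (j, True) then 1 else 0)" for j
      by (simp add: hits_def)
    have "(\<Sum>j\<in>{1..n} - {x}. hits j (e # h)) = (\<Sum>j\<in>{1..n} - {x}. hits j h)
        + (\<Sum>j\<in>{1..n} - {x}. if e = (j, True) then 1 else 0)"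
      by (simp only: H sum.distrib)
    moreover have "(\<Sum>j\<in>{1..n} - {x}. if e = (j, True) then 1 else (0::nat)) \<ge> 1"
      if "fst e \<noteq> x" "snd e"
    proof -
      have "fst e \<in> {1..n} - {x}" using Cons.prems[of e] that by simp
      moreover have "e = (fst e, True)" using that by (simp add: prod_eq_iff)
      ultimately show ?thesis
        using member_le_sum[of "fst e" "{1..n} - {x}" "\<lambda>j. if e = (j, True) then 1 else (0::nat)"]
        by simp
    qed
    ultimately show ?case using IH
      by (cases "fst e = x") (auto simp: guesses_def)
  qed
  then show ?thesis by (simp add: length_filter_conv_card)
qed

text \<open>Double counting: the swap inequality is summed over all positions still open to
  \<open>x\<close>, where each consistent deck has exactly \<open>m - hits x h\<close> copies of
  \<open>x\<close>. The product form also covers a nonpositive bracket and an empty set of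
  consistent decks.\<close>

lemma card_hit_bound:
  assumes h: "length h < m * n" and x: "x \<in> {1..n}"
    and r: "\<And>e. e \<in> set h \<Longrightarrow> fst e \<in> {1..n}"
  shows "real (card (consistent_decks m n (h @ [(x, True)])))
      * (real (m * n) - real (guesses x h) - (\<Sum>j\<in>{1..n} - {x}. real (hits j h)))
    \<le> (real m - real (hits x h)) * real (card (consistent_decks m n h))"
proof -
  let ?D = "consistent_decks m n h" and ?E = "consistent_decks m n (h @ [(x, True)])"
  let ?R = "{k. k < length h \<and> (fst (h ! k) = x \<or> snd (h ! k))}"
  define B where "B = {p. p < m * n \<and> (p < length h \<longrightarrow> fst (h ! p) \<noteq> x \<and> \<not> snd (h ! p))}"
  have fB: "finite B" by (simp add: B_def)
  have "{..<m * n} = B \<union> ?R" "B \<inter> ?R = {}" using h by (auto simp: B_def)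
  then have "m * n = card B + card ?R"
    by (metis card_Un_disjoint card_lessThan fB finite_Collect_conjI finite_Collect_less_nat)
  then have B: "real (m * n) - real (guesses x h) - (\<Sum>j\<in>{1..n} - {x}. real (hits j h)) \<le> real (card B)"
    using card_ruled_out_le[of h n x, OF r] by (simp flip: of_nat_sum of_nat_mult of_nat_add)
  have "card ?E * card B = (\<Sum>p\<in>B. card ?E)" by simp
  also have "\<dots> \<le> (\<Sum>p\<in>B. card {\<pi> \<in> ?D. \<pi> ! p = x})"
    by (intro sum_mono card_hit_le_swap[OF h]) (auto simp: B_def)
  also have "\<dots> = (\<Sum>p\<in>B. \<Sum>\<pi>\<in>?D. if \<pi> ! p = x then 1 else 0)"
    by (simp add: finite_consistent_decks flip: sum.inter_filter)
  also have "\<dots> = (\<Sum>\<pi>\<in>?D. \<Sum>p\<in>B. if \<pi> ! p = x then 1 else 0)"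
    by (rule sum.swap)
  also have "\<dots> = (\<Sum>\<pi>\<in>?D. m - hits x h)"
  proof (rule sum.cong[OF refl])
    fix \<pi> assume "\<pi> \<in> ?D"
    then have "card {p \<in> B. \<pi> ! p = x} + hits x h = m"
      using card_positions_hit[OF _ less_imp_le[OF h] x] by (simp add: B_def conj_ac)
    then show "(\<Sum>p\<in>B. if \<pi> ! p = x then 1 else 0) = m - hits x h"
      by (simp add: fB flip: sum.inter_filter)
  qed
  finally have *: "card ?E * card B \<le> (m - hits x h) * card ?D" by (simp add: mult.commute)
  show ?thesis
  proof (cases "?D = {}")
    case True
    then show ?thesis using h by (simp add: consistent_decks_snoc)
  next
    case False
    then have "hits x h \<le> m"
      using card_positions_hit[OF _ less_imp_le[OF h] x] by fastforce
    have "real (card ?E) * (real (m * n) - real (guesses x h) - (\<Sum>j\<in>{1..n} - {x}. real (hits j h)))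
        \<le> real (card ?E) * real (card B)"
      by (rule mult_left_mono[OF B]) simp
    also have "\<dots> \<le> real ((m - hits x h) * card ?D)"
      using * by (simp flip: of_nat_mult)
    finally show ?thesis using \<open>hits x h \<le> m\<close> by (simp add: of_nat_diff)
  qed
qed

lemma hits_le:
  assumes "\<pi> \<in> consistent_decks m n h" "length h \<le> m * n" "x \<in> {1..n}"
  shows "hits x h \<le> m"
  using card_positions_hit[OF assms] by linarith

lemma hits_snoc: "hits i (h @ [(x, b)]) = hits i h + (if i = x \<and> b then 1 else 0)"
  by (auto simp: hits_def)

lemma guesses_snoc: "guesses i (h @ [(x, b)]) = guesses i h + (if i = x then 1 else 0)"
  by (auto simp: guesses_def)

lemma sum_guesses_le: "(\<Sum>i\<in>{1..n}. guesses i h) \<le> length h"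
proof (induction h)
  case (Cons e h)
  have "(\<Sum>i\<in>{1..n}. guesses i (e # h))
      = (\<Sum>i\<in>{1..n}. guesses i h) + (\<Sum>i\<in>{1..n}. if i = fst e then 1 else 0)"
    unfolding sum.distrib[symmetric] by (rule sum.cong) (auto simp: guesses_def)
  also have "\<dots> \<le> length h + 1"
    using Cons by (intro add_mono) auto
  finally show ?case by simp
qed (simp add: guesses_def)

section \<open>The excessive function of a single card type\<close>

definition huber_slope :: "real \<Rightarrow> real \<Rightarrow> real" where
  "huber_slope K z = max 0 (min 1 (2 * K * z))"

text \<open>For \<open>K > 0\<close> this is the maximum of \<open>g * z - g^2 / (4 * K)\<close>
  over slopes \<open>g\<close> in [0,1]. Explicitly: 0 for z \<le> 0, then \<open>K * z^2\<close> up
  to \<open>z = 1 / (2 * K)\<close>, then \<open>z - 1 / (4 * K)\<close>.\<close>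

definition huber :: "real \<Rightarrow> real \<Rightarrow> real" where
  "huber K z = huber_slope K z * z - (huber_slope K z)\<^sup>2 / (4 * K)"

lemma huber_slope_nonneg: "0 \<le> huber_slope K z"
  and huber_slope_le_1: "huber_slope K z \<le> 1"
  by (auto simp: huber_slope_def)

lemma huber_cases:
  assumes "K > 0"
  obtains "z \<le> 0" "huber_slope K z = 0"
  | "z \<ge> 0" "2 * K * z \<le> 1" "huber_slope K z = 2 * K * z"
  | "z \<ge> 0" "2 * K * z \<ge> 1" "huber_slope K z = 1"
proof -
  have "2 * K * z \<le> 0 \<longleftrightarrow> z \<le> 0" using assms by (simp add: mult_le_0_iff)
  then show ?thesis using that unfolding huber_slope_def
    by (cases "z \<le> 0"; cases "2 * K * z \<le> 1") (auto simp: max_def min_def)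
qed

lemma huber_slope_diff:
  assumes "K > 0" "x \<le> y"
  shows "huber_slope K y \<le> huber_slope K x + 2 * K * (y - x)"
proof -
  have "2 * K * x \<le> 2 * K * y" using assms by simp
  then show ?thesis by (auto simp: huber_slope_def max_def min_def algebra_simps)
qed

text \<open>The clipped slope is optimal: in the quadratic range the defect is a square, and outside
  it an endpoint of [0,1] is the best slope.\<close>

lemma huber_ge:
  assumes K: "K > 0" and g: "0 \<le> g" "g \<le> 1"
  shows "g * z - g\<^sup>2 / (4 * K) \<le> huber K z"
proof (rule huber_cases[OF K, of z])
  assume "z \<le> 0" "huber_slope K z = 0"
  then have "g * z \<le> 0" "0 \<le> g\<^sup>2 / (4 * K)" "huber K z = 0"
    using K g by (auto simp: mult_le_0_iff huber_def)
  then show ?thesis by linarith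
next
  assume s: "huber_slope K z = 2 * K * z"
  have "0 \<le> (2 * K * z - g)\<^sup>2 / (4 * K)" using K by simp
  also have "\<dots> = huber K z - (g * z - g\<^sup>2 / (4 * K))"
    using K by (simp add: huber_def s field_simps power2_eq_square)
  finally show ?thesis by simp
next
  assume s: "huber_slope K z = 1" and z: "2 * K * z \<ge> 1"
  have "0 \<le> (1 - g) * (4 * K * z - (1 + g)) / (4 * K)"
    using K g z by (intro divide_nonneg_pos mult_nonneg_nonneg) auto
  also have "\<dots> = huber K z - (g * z - g\<^sup>2 / (4 * K))"
    using K by (simp add: huber_def s field_simps power2_eq_square)
  finally show ?thesis by simp
qed

lemma huber_nonneg: "K > 0 \<Longrightarrow> 0 \<le> huber K z"
  using huber_ge[of K 0 z] by simp

lemma huber_0: "huber K 0 = 0"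
  by (simp add: huber_def huber_slope_def)

text \<open>Convexity: the slope that is optimal at \<open>y\<close> is merely admissible at
  \<open>x\<close>.\<close>

lemma huber_tangent:
  assumes "K > 0"
  shows "huber K y + huber_slope K y * (x - y) \<le> huber K x"
  using huber_ge[OF assms huber_slope_nonneg huber_slope_le_1, of K y x]
  by (simp add: huber_def algebra_simps)

text \<open>In the quadratic range \<open>z * (1 - 2 * K * z)\<close> peaks at
  \<open>z = 1 / (4 * K)\<close>. This limits the profit from a type whose deficit has raised its
  success probability.\<close>

lemma mult_huber_slope_compl_le:
  assumes K: "K > 0"
  shows "z * (1 - huber_slope K z) \<le> 1 / (8 * K)"
proof (rule huber_cases[OF K, of z])
  assume s: "huber_slope K z = 2 * K * z"
  have "0 \<le> (1 - 4 * K * z)\<^sup>2 / (8 * K)" using K by simp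
  also have "\<dots> = 1 / (8 * K) - z * (1 - huber_slope K z)"
    using K by (simp add: s field_simps power2_eq_square)
  finally show ?thesis by simp
next
  assume "z \<le> 0" "huber_slope K z = 0"
  then show ?thesis using K by (simp add: order_trans[of z 0])
qed (use K in simp)

section \<open>Parameters and the excessive function\<close>

text \<open>Here \<delta> is half of m^(-1/4), and \<open>L\<close> caps the live hits.
  \<open>L_le\<close> keeps the hits on other types small against mn; \<open>L_ge\<close> makes the
  exponential supermartingale start at no more than \<open>\<delta> * m\<close>.\<close>

locale guessing_bound =
  fixes m n L :: nat and \<delta> :: real
  assumes m2: "m \<ge> 2" and \<delta>: "\<delta> > 0" and m_\<delta>: "real m * (16 * \<delta> ^ 4) = 1"
    and n: "n \<ge> 1"
    and L_le: "real (L + m) \<le> real (m * n) * (\<delta> ^ 3 / 12)"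
    and L_ge: "real n * exp (2 * real m / \<delta>) \<le> \<delta> * 2 ^ L"
begin

definition N :: real where "N = real m * real n"
text \<open>Balances two errors of order \<delta>: a deficit contributes at most
  \<open>1 / (8 * K)\<close> divided by a remaining fraction above \<delta>, and one hit moves the
  slope by at most \<open>2 * K / m\<close>, weighted by a normalised success probability of at most
  \<open>2 / \<delta>\<close>.\<close>

definition K :: real where "K = 1 / (4 * \<delta>\<^sup>2)"
definition rate :: real where "rate = (1 + 20 * \<delta>) / real n"
definition retired :: "nat \<Rightarrow> bool" where "retired a \<longleftrightarrow> (1 - \<delta>) * N \<le> real a"
definition Q :: "nat \<Rightarrow> nat \<Rightarrow> real" where
  "Q a s = real m * (huber K (real a / N - real s / real m) + (2 * \<delta> + 2 * \<delta>\<^sup>2) * (real a / N))"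
definition V :: "nat \<Rightarrow> nat \<Rightarrow> real" where
  "V a s = (if retired a then real m - real s else Q a s)"

lemma m_pos: "real m > 0" and n_pos: "real n > 0" and N_pos: "N > 0"
  using m2 n by (auto simp: N_def)

lemma K_pos: "K > 0"
  using \<delta> by (simp add: K_def)

lemma \<delta>_less: "\<delta> < 1/2"
proof (rule ccontr)
  assume "\<not> \<delta> < 1/2"
  then have "(1/2) ^ 4 \<le> \<delta> ^ 4" by (intro power_mono) auto
  then have "2 * (16 * (1/2)^4) \<le> real m * (16 * \<delta> ^ 4)" using m2 by (intro mult_mono) auto
  then show False using m_\<delta> by (simp add: power_divide)
qed

lemma \<delta>2_le: "\<delta>\<^sup>2 \<le> \<delta> / 2"
  using \<delta> \<delta>_less by (simp add: power2_eq_square)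

lemma K_over_m: "2 * K / real m = 8 * \<delta>\<^sup>2"
proof -
  have "8 * \<delta>\<^sup>2 * real m = real m * (16 * \<delta> ^ 4) / (2 * \<delta>\<^sup>2)"
    using \<delta> by (simp add: power2_eq_square power4_eq_xxxx)
  also have "\<dots> = 2 * K" using m_\<delta> by (simp add: K_def)
  finally show ?thesis using m_pos by (simp add: field_simps)
qed

text \<open>The slope-one line below the Huber function falls short of \<open>1 - y\<close> by at
  most \<open>\<delta> + \<delta>^2\<close>. The drift term of \<open>Q\<close> covers this because
  \<open>a / N\<close> is at least 1/2.\<close>

lemma Q_ge_if_retired:
  assumes "retired a"
  shows "real m - real s \<le> Q a s"
proof -
  define x y where "x = real a / N" and "y = real s / real m"
  have x: "1 - \<delta> \<le> x"
    using assms N_pos by (simp add: retired_def x_def field_simps)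
  have "(x - y) - \<delta>\<^sup>2 \<le> huber K (x - y)"
    using huber_ge[OF K_pos, of 1 "x - y"] \<delta> by (simp add: K_def)
  moreover have "\<delta> + \<delta>\<^sup>2 \<le> (2 * \<delta> + 2 * \<delta>\<^sup>2) * x"
    using mult_left_mono[of "1/2" x "2 * \<delta> + 2 * \<delta>\<^sup>2"] x \<delta>_less \<delta> by simp
  ultimately have "1 - y \<le> huber K (x - y) + (2 * \<delta> + 2 * \<delta>\<^sup>2) * x" using x by linarith
  then have "real m * (1 - y) \<le> Q a s"
    unfolding Q_def x_def y_def using m_pos by (intro mult_left_mono) auto
  then show ?thesis using m_pos by (simp add: y_def right_diff_distrib)
qed

lemma V_le_Q: "V a s \<le> Q a s"
  by (simp add: V_def Q_ge_if_retired)

lemma V_nonneg: "s \<le> m \<Longrightarrow> 0 \<le> V a s"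
  using m_pos N_pos \<delta> by (auto simp: V_def Q_def huber_nonneg[OF K_pos])

lemma V_0: "V 0 0 = 0"
  using N_pos \<delta>_less by (simp add: V_def Q_def huber_0 retired_def mult_le_0_iff)

text \<open>A miss raises \<open>Q\<close> by about \<open>g / n\<close>, and a hit gains about
  \<open>1 - g\<close> over a miss. With success probability 1/n these sum to 1/n. A positive
  deficit \<open>d\<close> raises the probability by a factor of about \<open>1 + d / u\<close>, but
  then \<open>1 - g\<close> is small enough to keep the excess of order \<delta>.\<close>

lemma Q_step:
  assumes a: "\<not> retired a" and p: "0 \<le> p"
    and c: "0 \<le> c" "c \<le> N * (\<delta> ^ 3 / 12)"
    and hit: "p * (N - real a - c) \<le> real m - real s"
  shows "p * (1 + Q (Suc a) (Suc s)) + (1 - p) * Q (Suc a) s \<le> Q a s + rate"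
proof -
  define H where "H = huber K"
  define \<eta> where "\<eta> = 2 * \<delta> + 2 * \<delta>\<^sup>2"
  define u y d e where "u = 1 - real a / N" and "y = real s / real m"
    and "d = real a / N - real s / real m" and "e = real (Suc a) / N - real s / real m"
  define g where "g = huber_slope K e"
  define q where "q = real n * p"
  define w where "w = 1 + Q (Suc a) (Suc s) - Q (Suc a) s"
  have g: "0 \<le> g" "g \<le> 1" by (auto simp: g_def huber_slope_nonneg huber_slope_le_1)
  have e: "e = d + 1 / N" by (simp add: e_def d_def add_divide_distrib)
  have u: "\<delta> < u" "u \<le> 1"
    using a N_pos by (auto simp: retired_def u_def field_simps)
  have q: "0 \<le> q" using p by (simp add: q_def)
  have ud: "1 - y = u + d" by (simp add: u_def y_def d_def)
  have QS: "Q (Suc a) (Suc s) = real m * (H (e - 1 / real m) + \<eta> * (real (Suc a) / N))"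
    "Q (Suc a) s = real m * (H e + \<eta> * (real (Suc a) / N))"
    "Q a s = real m * (H d + \<eta> * (real a / N))"
    by (auto simp: Q_def H_def \<eta>_def e_def d_def add_divide_distrib diff_diff_eq add.commute)
  have w: "w = 1 - real m * (H e - H (e - 1 / real m))"
    by (simp add: w_def QS algebra_simps)
  \<comment> \<open>The tangents at the two ends of the jump caused by a hit bound \<open>w\<close>
    from below and above.\<close>
  have "H e - g * (1 / real m) \<le> H (e - 1 / real m)"
    using huber_tangent[OF K_pos, of e "e - 1 / real m"] by (simp add: H_def g_def)
  then have "real m * (H e - H (e - 1 / real m)) \<le> g"
    using m_pos by (simp add: field_simps)
  then have w0: "0 \<le> w" using w g by linarith
  have "H (e - 1 / real m) + huber_slope K (e - 1 / real m) * (1 / real m) \<le> H e"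
    using huber_tangent[OF K_pos, of "e - 1 / real m" e] by (simp add: H_def)
  then have "huber_slope K (e - 1 / real m) \<le> real m * (H e - H (e - 1 / real m))"
    using m_pos by (simp add: field_simps)
  moreover have "g \<le> huber_slope K (e - 1 / real m) + 8 * \<delta>\<^sup>2"
    using huber_slope_diff[OF K_pos, of "e - 1 / real m" e] K_over_m m_pos by (simp add: g_def)
  ultimately have w1: "w \<le> (1 - g) + 8 * \<delta>\<^sup>2" using w by linarith
  have "H e - H d \<le> g * (1 / N)"
    using huber_tangent[OF K_pos, of e d] by (simp add: H_def g_def e)
  then have "real m * (H e - H d) \<le> real m * (g * (1 / N))"
    using m_pos by (intro mult_left_mono) auto
  also have "\<dots> = g / real n" using m_pos by (simp add: N_def)
  finally have *: "real m * (H e - H d) \<le> g / real n" .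
  have inc: "Q (Suc a) s - Q a s \<le> (g + \<eta>) / real n"
  proof -
    have "real (Suc a) / N - real a / N = 1 / N" by (simp flip: diff_divide_distrib)
    then have "Q (Suc a) s - Q a s = real m * (H e - H d) + \<eta> * (real m * (1 / N))"
      unfolding QS by algebra
    also have "real m * (1 / N) = 1 / real n" using m_pos by (simp add: N_def)
    finally show ?thesis using * by (simp add: add_divide_distrib)
  qed
  have cN: "0 \<le> c / N" "c / N \<le> \<delta> ^ 3 / 12"
    using c N_pos by (auto simp: field_simps)
  have \<delta>3: "\<delta> ^ 3 / 12 \<le> \<delta> / 2"
  proof -
    have "\<delta> ^ 3 \<le> \<delta> ^ 1" using \<delta> \<delta>_less by (intro power_decreasing) auto
    then show ?thesis using \<delta> by simp
  qed
  have "q * (u - c / N) = p * (N - real a - c) / real m"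
    using m_pos n_pos by (simp add: q_def u_def N_def field_simps)
  also have "\<dots> \<le> (real m - real s) / real m"
    using hit by (intro divide_right_mono) auto
  also have "\<dots> = 1 - y" using m_pos by (simp add: y_def diff_divide_distrib)
  finally have q1: "q * (u - c / N) \<le> 1 - y" .
  \<comment> \<open>A crude bound on \<open>q\<close> comes first; it then shows that
    \<open>c\<close> perturbs the sharp bound by only \<open>\<delta> / 6\<close>.\<close>
  have "q * (\<delta> / 2) \<le> q * (u - c / N)"
    using q u cN \<delta>3 by (intro mult_left_mono) auto
  also have "\<dots> \<le> 1" using q1 m_pos by (simp add: y_def order_trans[OF q1])
  finally have q2: "q \<le> 2 / \<delta>" using \<delta> by (simp add: field_simps)
  have "q * (c / N) \<le> (2 / \<delta>) * (\<delta> ^ 3 / 12)"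
    using q q2 cN \<delta> by (intro mult_mono) auto
  also have "\<dots> = \<delta> * (\<delta> / 6)" using \<delta> by (simp add: power3_eq_cube)
  also have "\<dots> \<le> u * (\<delta> / 6)" using u \<delta> by (intro mult_right_mono) auto
  finally have "q * (c / N) \<le> u * (\<delta> / 6)" .
  moreover have "q * u - q * (c / N) \<le> u + d" using q1 ud by (simp only: right_diff_distrib)
  ultimately have "q * u \<le> u + d + u * (\<delta> / 6)" by linarith
  also have "\<dots> = (1 + d / u + \<delta> / 6) * u" using u \<delta> by (simp add: algebra_simps)
  finally have "q * u \<le> (1 + d / u + \<delta> / 6) * u" .
  then have q3: "q \<le> 1 + d / u + \<delta> / 6"
    using u \<delta> by (simp add: mult_le_cancel_right)
  have "d * (1 - g) \<le> e * (1 - g)"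
    using g N_pos by (intro mult_right_mono) (auto simp: e)
  also have "\<dots> \<le> \<delta>\<^sup>2 / 2"
    using mult_huber_slope_compl_le[OF K_pos, of e] \<delta> by (simp add: g_def K_def)
  finally have "d * (1 - g) / u \<le> (\<delta>\<^sup>2 / 2) / \<delta>"
    using u \<delta> by (intro frac_le) auto
  then have du: "d / u * (1 - g) \<le> \<delta> / 2" using \<delta> by (simp add: power2_eq_square)
  have "q * w \<le> q * (1 - g) + q * (8 * \<delta>\<^sup>2)"
    using mult_left_mono[OF w1 q] by (simp add: distrib_left)
  also have "q * (1 - g) \<le> (1 + d / u + \<delta> / 6) * (1 - g)"
    using q3 g by (intro mult_right_mono) auto
  also have "(1 + d / u + \<delta> / 6) * (1 - g) = (1 - g) + d / u * (1 - g) + \<delta> / 6 * (1 - g)"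
    by (simp add: algebra_simps)
  also have "\<delta> / 6 * (1 - g) \<le> \<delta> / 6" using \<delta> g by (simp add: mult_left_le)
  also have "q * (8 * \<delta>\<^sup>2) \<le> 2 / \<delta> * (8 * \<delta>\<^sup>2)"
    using q2 by (intro mult_right_mono) auto
  also have "2 / \<delta> * (8 * \<delta>\<^sup>2) = 16 * \<delta>" using \<delta> by (simp add: power2_eq_square)
  finally have "q * w \<le> (1 - g) + \<delta> / 2 + \<delta> / 6 + 16 * \<delta>" using du by linarith
  moreover have "\<eta> \<le> 3 * \<delta>" using \<delta>2_le by (simp add: \<eta>_def)
  \<comment> \<open>The slope \<open>g\<close> cancels, and 1/2 + 1/6 + 16 + 3 < 20.\<close>
  ultimately have "q * w + (g + \<eta>) \<le> 1 + 20 * \<delta>" using \<delta> by linarith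
  then have "(q * w + (g + \<eta>)) / real n \<le> rate"
    unfolding rate_def using n_pos by (intro divide_right_mono) auto
  then have "p * w + (g + \<eta>) / real n \<le> rate"
    using n_pos by (simp add: q_def add_divide_distrib)
  then have "p * w + (Q (Suc a) s - Q a s) \<le> rate" using inc by linarith
  then show ?thesis by (simp add: w_def algebra_simps)
qed

text \<open>For a retired type a hit scores one and lowers \<open>V\<close> by one, so any
  \<open>p\<close> is harmless. For a live type \<open>V\<close> equals \<open>Q\<close> now and is
  at most \<open>Q\<close> after the guess, even if that guess retires the type.\<close>

lemma V_step:
  assumes p: "0 \<le> p" "p \<le> 1"
    and c: "0 \<le> c" "c \<le> N * (\<delta> ^ 3 / 12)"
    and hit: "\<not> retired a \<Longrightarrow> p * (N - real a - c) \<le> real m - real s"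
  shows "p * (1 + V (Suc a) (Suc s)) + (1 - p) * V (Suc a) s \<le> V a s + rate"
proof (cases "retired a")
  case True
  then have "retired (Suc a)" by (simp add: retired_def)
  moreover have "0 \<le> rate" using \<delta> by (simp add: rate_def)
  ultimately show ?thesis using True by (simp add: V_def algebra_simps)
next
  case False
  have "p * (1 + V (Suc a) (Suc s)) + (1 - p) * V (Suc a) s
      \<le> p * (1 + Q (Suc a) (Suc s)) + (1 - p) * Q (Suc a) s"
    using p V_le_Q by (intro add_mono mult_left_mono) auto
  also have "\<dots> \<le> Q a s + rate"
    using Q_step[OF False p(1) c hit[OF False]] .
  finally show ?thesis using False by (simp add: V_def)
qed

end

section \<open>Backward induction over the game\<close>

lemma play_le_length: "play G h cs \<le> length cs"
  by (induction cs arbitrary: h) (auto simp: Let_def le_SucI)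

lemma play_const: "play (\<lambda>_. c) h cs = count_list cs c"
  by (induction cs arbitrary: h) (auto simp: Let_def)

context guessing_bound
begin

text \<open>Hits of retired types are left out because their success probability need not be \<open>O(1/n)\<close>;
  at most one type can retire, so this loses at most \<open>m\<close> hits. Once \<open>L\<close> live hits are reached,
  \<open>\<Psi>\<close> alone exceeds the trivial bound \<open>N\<close> on the remaining score.\<close>
definition live_hits :: "(nat \<times> bool) list \<Rightarrow> nat" where
  "live_hits h = (\<Sum>i\<in>{1..n}. if retired (guesses i h) then 0 else hits i h)"

definition hit_rate :: real where "hit_rate = 2 / (\<delta> * real n)"

text \<open>The power of \<open>1 + hit_rate\<close> offsets the expected growth of
  \<open>2 ^ live_hits h\<close> over the remaining rounds.\<close>

definition \<Psi> :: "(nat \<times> bool) list \<Rightarrow> real" where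
  "\<Psi> h = N / 2 ^ L * (1 + hit_rate) ^ (m * n - length h) * 2 ^ live_hits h"

text \<open>The potential bounding the expected remaining score: a charge of \<open>rate\<close> per
  remaining round, the excessive functions of all types, and the penalty for many live hits.\<close>

definition \<Phi> :: "(nat \<times> bool) list \<Rightarrow> real" where
  "\<Phi> h = rate * (N - real (length h)) + (\<Sum>i\<in>{1..n}. V (guesses i h) (hits i h)) + \<Psi> h"

lemma rate_nonneg: "0 \<le> rate" and hit_rate_nonneg: "0 \<le> hit_rate"
  using \<delta> by (auto simp: rate_def hit_rate_def)

lemma \<Psi>_nonneg: "0 \<le> \<Psi> h"
  using N_pos hit_rate_nonneg by (simp add: \<Psi>_def)

lemma \<Psi>_ge:
  assumes "L \<le> live_hits h"
  shows "N \<le> \<Psi> h"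
proof -
  have "N = N / 2 ^ L * 1 * 2 ^ L" by simp
  also have "\<dots> \<le> \<Psi> h" unfolding \<Psi>_def
    using N_pos hit_rate_nonneg assms by (intro mult_mono) auto
  finally show ?thesis .
qed

text \<open>Two retired types would need \<open>2 * (1 - \<delta>) * N\<close> guesses, more than
  the \<open>N\<close> available.\<close>

lemma retired_unique:
  assumes "length h \<le> m * n" "i \<in> {1..n}" "j \<in> {1..n}" "retired (guesses i h)" "retired (guesses j h)"
  shows "i = j"
proof (rule ccontr)
  assume "i \<noteq> j"
  then have "guesses i h + guesses j h = (\<Sum>k\<in>{i, j}. guesses k h)" by simp
  also have "\<dots> \<le> (\<Sum>k\<in>{1..n}. guesses k h)" using assms by (intro sum_mono2) auto
  also have "\<dots> \<le> m * n" using sum_guesses_le assms(1) by (rule order_trans)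
  finally have "real (guesses i h) + real (guesses j h) \<le> N"
    unfolding N_def by (simp flip: of_nat_add of_nat_mult)
  then have "2 * ((1 - \<delta>) * N) \<le> N" using assms by (simp add: retired_def)
  then have "2 * (1 - \<delta>) \<le> 1" using N_pos by simp
  then show False using \<delta>_less by simp
qed

lemma sum_hits_le:
  assumes h: "length h \<le> m * n" and s: "\<And>i. i \<in> {1..n} \<Longrightarrow> hits i h \<le> m"
  shows "(\<Sum>j\<in>{1..n} - {x}. hits j h) \<le> live_hits h + m"
proof -
  let ?R = "{i \<in> {1..n}. retired (guesses i h)}"
  have "(\<Sum>j\<in>{1..n} - {x}. hits j h) \<le> (\<Sum>j\<in>{1..n}. hits j h)"
    by (intro sum_mono2) auto
  also have "\<dots> = live_hits h + (\<Sum>j\<in>{1..n}. if retired (guesses j h) then hits j h else 0)"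
    unfolding live_hits_def sum.distrib[symmetric] by (rule sum.cong) auto
  also have "(\<Sum>j\<in>{1..n}. if retired (guesses j h) then hits j h else 0) = (\<Sum>j\<in>?R. hits j h)"
    by (simp only: sum.inter_filter finite_atLeastAtMost)
  also have "\<dots> \<le> card ?R * m"
    using s by (intro sum_bounded_above[where 'a = nat, simplified]) auto
  also have "card ?R \<le> 1"
    using retired_unique[OF h] by (auto simp: card_le_Suc0_iff_eq)
  finally show ?thesis by simp
qed

text \<open>Only an inequality, since a guess that retires its type drops all hits of that type from
  the count.\<close>

lemma live_hits_snoc:
  assumes "x \<in> {1..n}"
  shows "live_hits (h @ [(x, b)]) \<le> live_hits h + (if b \<and> \<not> retired (guesses x h) then 1 else 0)"
proof -
  have mono: "retired a \<Longrightarrow> retired (Suc a)" for a by (simp add: retired_def)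
  have "live_hits (h @ [(x, b)]) \<le> (\<Sum>i\<in>{1..n}. (if retired (guesses i h) then 0 else hits i h)
      + (if i = x then if b \<and> \<not> retired (guesses x h) then 1 else 0 else 0))"
    unfolding live_hits_def by (intro sum_mono) (auto simp: hits_snoc guesses_snoc dest: mono)
  also have "\<dots> = live_hits h + (if b \<and> \<not> retired (guesses x h) then 1 else 0)"
    using assms by (simp add: sum.distrib live_hits_def)
  finally show ?thesis .
qed

lemma \<Psi>_step:
  assumes x: "x \<in> {1..n}" and h: "length h < m * n" and p: "0 \<le> p" "p \<le> 1"
    and hit: "\<not> retired (guesses x h) \<Longrightarrow> p \<le> hit_rate"
  shows "p * \<Psi> (h @ [(x, True)]) + (1 - p) * \<Psi> (h @ [(x, False)]) \<le> \<Psi> h"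
proof -
  define l where "l = live_hits h"
  define \<beta> where "\<beta> = N / 2 ^ L * (1 + hit_rate) ^ (m * n - Suc (length h))"
  define z where "z = (if retired (guesses x h) then 1 else 2 :: real)"
  have \<beta>: "0 \<le> \<beta>" using N_pos hit_rate_nonneg by (simp add: \<beta>_def)
  have \<Psi>_eq: "\<Psi> (h @ [(x, b)]) = \<beta> * 2 ^ live_hits (h @ [(x, b)])" for b
    by (simp add: \<Psi>_def \<beta>_def)
  have "(2::real) ^ live_hits (h @ [(x, True)]) \<le> 2 ^ (l + (if retired (guesses x h) then 0 else 1))"
    using live_hits_snoc[OF x, of h True] by (intro power_increasing) (auto simp: l_def split: if_splits)
  also have "\<dots> = 2 ^ l * z" by (simp add: z_def)
  finally have 1: "\<Psi> (h @ [(x, True)]) \<le> \<beta> * (2 ^ l * z)"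
    using mult_left_mono[OF _ \<beta>] by (simp add: \<Psi>_eq)
  have "(2::real) ^ live_hits (h @ [(x, False)]) \<le> 2 ^ l"
    using live_hits_snoc[OF x, of h False] by (intro power_increasing) (auto simp: l_def)
  then have 0: "\<Psi> (h @ [(x, False)]) \<le> \<beta> * 2 ^ l"
    using mult_left_mono[OF _ \<beta>] by (simp add: \<Psi>_eq)
  have "p * \<Psi> (h @ [(x, True)]) + (1 - p) * \<Psi> (h @ [(x, False)])
      \<le> p * (\<beta> * (2 ^ l * z)) + (1 - p) * (\<beta> * 2 ^ l)"
    using p 0 1 by (intro add_mono mult_left_mono) auto
  also have "\<dots> = \<beta> * 2 ^ l * (1 + p * (z - 1))" by (simp add: algebra_simps)
  also have "\<dots> \<le> \<beta> * 2 ^ l * (1 + hit_rate)"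
    using \<beta> hit hit_rate_nonneg by (intro mult_left_mono) (auto simp: z_def)
  also have "\<dots> = \<Psi> h"
  proof -
    have "m * n - length h = Suc (m * n - Suc (length h))" using h by simp
    then show ?thesis by (simp add: \<Psi>_def \<beta>_def l_def)
  qed
  finally show ?thesis .
qed

lemma sum_V_snoc:
  assumes "x \<in> {1..n}"
  shows "(\<Sum>i\<in>{1..n}. V (guesses i (h @ [(x, b)])) (hits i (h @ [(x, b)])))
    = (\<Sum>i\<in>{1..n} - {x}. V (guesses i h) (hits i h))
      + V (Suc (guesses x h)) (if b then Suc (hits x h) else hits x h)"
proof -
  have "(\<Sum>i\<in>{1..n} - {x}. V (guesses i (h @ [(x, b)])) (hits i (h @ [(x, b)])))
      = (\<Sum>i\<in>{1..n} - {x}. V (guesses i h) (hits i h))"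
    by (rule sum.cong) (auto simp: guesses_snoc hits_snoc)
  then show ?thesis
    by (subst sum.remove[OF _ assms]) (auto simp: guesses_snoc hits_snoc)
qed

text \<open>Only the guessed type changes its state, so \<open>V_step\<close> for that type, paid
  for by the round used up, combines with \<open>\<Psi>_step\<close>. The cap on live hits makes
  \<open>c\<close> small enough for both.\<close>

lemma \<Phi>_step:
  assumes x: "x \<in> {1..n}" and h: "length h < m * n" and p: "0 \<le> p" "p \<le> 1"
    and s: "\<And>i. i \<in> {1..n} \<Longrightarrow> hits i h \<le> m" and l: "live_hits h \<le> L"
    and hit: "p * (N - real (guesses x h) - (\<Sum>j\<in>{1..n} - {x}. real (hits j h)))
      \<le> real m - real (hits x h)"
  shows "p * (1 + \<Phi> (h @ [(x, True)])) + (1 - p) * \<Phi> (h @ [(x, False)]) \<le> \<Phi> h"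
proof -
  define a s where "a = guesses x h" and "s = hits x h"
  define c where "c = (\<Sum>j\<in>{1..n} - {x}. real (hits j h))"
  define W where "W = (\<Sum>i\<in>{1..n} - {x}. V (guesses i h) (hits i h))"
  have c0: "0 \<le> c" by (simp add: c_def sum_nonneg)
  have "(\<Sum>j\<in>{1..n} - {x}. hits j h) \<le> L + m"
    using sum_hits_le[of h x] s l h by simp
  then have "c \<le> real (L + m)" by (simp add: c_def flip: of_nat_sum of_nat_add)
  with L_le have c: "c \<le> N * (\<delta> ^ 3 / 12)" by (simp add: N_def)
  have "p \<le> hit_rate" if "\<not> retired (guesses x h)"
  proof -
    have "\<delta> ^ 3 \<le> \<delta> ^ 1" using \<delta> \<delta>_less by (intro power_decreasing) auto
    then have "N * (\<delta> ^ 3 / 12) \<le> N * (\<delta> / 2)" using N_pos \<delta> by (intro mult_left_mono) auto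
    \<comment> \<open>A live type leaves more than \<open>\<delta> * N\<close> positions, of which
      \<open>c\<close> takes at most half.\<close>
    then have "N * (\<delta> / 2) \<le> N - real a - c"
      using that c by (simp add: retired_def a_def algebra_simps)
    then have "p * (N * (\<delta> / 2)) \<le> p * (N - real a - c)" using p by (intro mult_left_mono)
    also have "\<dots> \<le> real m" using hit by (simp add: a_def c_def)
    finally show ?thesis using N_pos m_pos n_pos \<delta> by (simp add: hit_rate_def N_def field_simps)
  qed
  then have \<Psi>: "p * \<Psi> (h @ [(x, True)]) + (1 - p) * \<Psi> (h @ [(x, False)]) \<le> \<Psi> h"
    using \<Psi>_step[OF x h p] by blast
  have V: "p * (1 + V (Suc a) (Suc s)) + (1 - p) * V (Suc a) s \<le> V a s + rate"
    using V_step[OF p c0 c, of a s] hit by (simp add: a_def s_def c_def)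
  define \<rho> where "\<rho> = rate * (N - real (length h))"
  have 1: "\<Phi> (h @ [(x, True)]) = \<rho> - rate + (W + V (Suc a) (Suc s)) + \<Psi> (h @ [(x, True)])"
    and 0: "\<Phi> (h @ [(x, False)]) = \<rho> - rate + (W + V (Suc a) s) + \<Psi> (h @ [(x, False)])"
    unfolding \<Phi>_def sum_V_snoc[OF x] by (auto simp: W_def a_def s_def \<rho>_def algebra_simps)
  have "\<Phi> h = \<rho> + (W + V a s) + \<Psi> h"
    unfolding \<Phi>_def by (subst sum.remove[OF _ x]) (auto simp: W_def a_def s_def \<rho>_def)
  moreover have "p * (1 + \<Phi> (h @ [(x, True)])) + (1 - p) * \<Phi> (h @ [(x, False)])
      = \<rho> - rate + W + (p * (1 + V (Suc a) (Suc s)) + (1 - p) * V (Suc a) s)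
        + (p * \<Psi> (h @ [(x, True)]) + (1 - p) * \<Psi> (h @ [(x, False)]))"
    unfolding 0 1 by (simp add: algebra_simps)
  ultimately show ?thesis using V \<Psi> by linarith
qed

text \<open>Induction on the number \<open>k\<close> of remaining rounds. Sums over consistent decks
  replace conditional expectations, so impossible histories need no normalisation.\<close>

lemma sum_play_le:
  assumes G: "G \<in> strategies n" and "length h + k = m * n"
    and "\<And>e. e \<in> set h \<Longrightarrow> fst e \<in> {1..n}"
  shows "(\<Sum>\<pi>\<in>consistent_decks m n h. real (play G h (drop (length h) \<pi>)))
    \<le> real (card (consistent_decks m n h)) * \<Phi> h"
  using assms(2,3)
proof (induction k arbitrary: h)
  case (0 h)
  have "0 \<le> \<Phi> h" if "\<pi> \<in> consistent_decks m n h" for \<pi>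
  proof -
    have "N = real (length h)" using 0 by (simp add: N_def flip: of_nat_mult)
    moreover have "0 \<le> (\<Sum>i\<in>{1..n}. V (guesses i h) (hits i h))"
      using hits_le[OF that] 0 by (intro sum_nonneg V_nonneg) auto
    ultimately show ?thesis using \<Psi>_nonneg by (simp add: \<Phi>_def)
  qed
  moreover have "drop (length h) \<pi> = []" if "\<pi> \<in> consistent_decks m n h" for \<pi>
    using that 0 by (auto simp: consistent_decks_def dest: length_decks)
  ultimately show ?case
    by (cases "consistent_decks m n h = {}") (auto intro!: mult_nonneg_nonneg)
next
  case (Suc k h)
  let ?D = "consistent_decks m n"
  have h: "length h < m * n" using Suc.prems(1) by simp
  show ?case
  proof (cases "?D h = {}")
    case True
    then show ?thesis by simp
  next
    case nonempty: False
    then obtain \<pi>0 where \<pi>0: "\<pi>0 \<in> ?D h" by blast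
    have s: "hits i h \<le> m" if "i \<in> {1..n}" for i
      using hits_le[OF \<pi>0 _ that] h by simp
    have len: "length \<pi> = m * n" if "\<pi> \<in> ?D g" for \<pi> g
      using that by (auto simp: consistent_decks_def dest: length_decks)
    show ?thesis
    \<comment> \<open>With \<open>L\<close> live hits \<open>\<Psi>\<close> already exceeds the
      trivial bound; below \<open>L\<close> the one-step inequality applies.\<close>
    proof (cases "L \<le> live_hits h")
      case True
      have "0 \<le> (\<Sum>i\<in>{1..n}. V (guesses i h) (hits i h))"
        using s by (intro sum_nonneg V_nonneg) auto
      moreover have "0 \<le> rate * (N - real (length h))"
        using h rate_nonneg by (intro mult_nonneg_nonneg) (auto simp: N_def simp flip: of_nat_mult)
      ultimately have "N \<le> \<Phi> h" using \<Psi>_ge[OF True] by (simp add: \<Phi>_def)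
      moreover have "real (play G h (drop (length h) \<pi>)) \<le> N" if "\<pi> \<in> ?D h" for \<pi>
        using play_le_length[of G h "drop (length h) \<pi>"] len[OF that]
        by (simp add: N_def flip: of_nat_mult)
      ultimately show ?thesis by (intro sum_bounded_above) (rule order_trans)
    next
      case False
      define x where "x = G h"
      define A B where "A = ?D (h @ [(x, True)])" and "B = ?D (h @ [(x, False)])"
      \<comment> \<open>The conditional probability that the next guess is correct.\<close>
      define p where "p = real (card A) / real (card (?D h))"
      have x: "x \<in> {1..n}" using G by (simp add: x_def strategies_def)
      have AB: "?D h = A \<union> B" "A \<inter> B = {}" "finite A" "finite B"
        by (auto simp: A_def B_def consistent_decks_snoc[OF h] finite_consistent_decks)
      have cD: "0 < real (card (?D h))"
        using nonempty by (simp add: card_gt_0_iff finite_consistent_decks)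
      have card: "real (card (?D h)) = real (card A) + real (card B)"
        unfolding AB(1) using AB by (simp add: card_Un_disjoint)
      have pA: "real (card A) = real (card (?D h)) * p"
        and pB: "real (card B) = real (card (?D h)) * (1 - p)"
        using cD card by (auto simp: p_def field_simps)
      have p: "0 \<le> p" "p \<le> 1" using cD card by (auto simp: p_def)
      have "real (card A) * (N - real (guesses x h) - (\<Sum>j\<in>{1..n} - {x}. real (hits j h)))
          \<le> (real m - real (hits x h)) * real (card (?D h))"
        using card_hit_bound[OF h x Suc.prems(2)] by (simp add: A_def N_def)
      then have hit: "p * (N - real (guesses x h) - (\<Sum>j\<in>{1..n} - {x}. real (hits j h)))
          \<le> real m - real (hits x h)"
        using cD by (simp add: p_def pos_divide_le_eq)
      have play: "play G h (drop (length h) \<pi>) = (if b then 1 else 0)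
            + play G (h @ [(x, b)]) (drop (length (h @ [(x, b)])) \<pi>)"
        if "\<pi> \<in> ?D (h @ [(x, b)])" for \<pi> b
      proof -
        have "drop (length h) \<pi> = \<pi> ! length h # drop (Suc (length h)) \<pi>"
          using len[OF that] h by (simp add: Cons_nth_drop_Suc)
        moreover have "(x = \<pi> ! length h) = b"
          using that by (auto simp: consistent_decks_snoc[OF h])
        ultimately show ?thesis by (simp add: Let_def x_def)
      qed
      have IH: "(\<Sum>\<pi>\<in>?D (h @ [(x, b)]).
            real (play G (h @ [(x, b)]) (drop (length (h @ [(x, b)])) \<pi>)))
          \<le> real (card (?D (h @ [(x, b)]))) * \<Phi> (h @ [(x, b)])" for b
        using Suc.prems x by (intro Suc.IH) auto
      have "(\<Sum>\<pi>\<in>A. real (play G h (drop (length h) \<pi>)))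
          \<le> real (card A) * (1 + \<Phi> (h @ [(x, True)]))"
        using IH[of True] by (simp add: A_def play sum.distrib distrib_left)
      moreover have "(\<Sum>\<pi>\<in>B. real (play G h (drop (length h) \<pi>)))
          \<le> real (card B) * \<Phi> (h @ [(x, False)])"
        using IH[of False] by (simp add: B_def play)
      ultimately have "(\<Sum>\<pi>\<in>?D h. real (play G h (drop (length h) \<pi>)))
          \<le> real (card A) * (1 + \<Phi> (h @ [(x, True)])) + real (card B) * \<Phi> (h @ [(x, False)])"
        unfolding AB(1) using AB by (subst sum.union_disjoint) auto
      also have "\<dots> = real (card (?D h))
          * (p * (1 + \<Phi> (h @ [(x, True)])) + (1 - p) * \<Phi> (h @ [(x, False)]))"
        unfolding pA pB by (simp add: algebra_simps)
      also have "\<dots> \<le> real (card (?D h)) * \<Phi> h"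
        using \<Phi>_step[OF x h p s _ hit] False by (intro mult_left_mono) auto
      finally show ?thesis .
    qed
  qed
qed

text \<open>All fresh types have \<open>V\<close> equal to 0, the charges total
  \<open>(1 + 20 * \<delta>) * m\<close>, and \<open>1 + x \<le> exp x\<close> with
  \<open>L_ge\<close> bounds the initial \<open>\<Psi>\<close> by
  \<open>\<delta> * m\<close>.\<close>

lemma \<Phi>_Nil_le: "\<Phi> [] \<le> real m + 21 * \<delta> * real m"
proof -
  have "(1 + hit_rate) ^ (m * n) \<le> exp hit_rate ^ (m * n)"
    using hit_rate_nonneg by (intro power_mono) (auto simp: exp_ge_add_one_self)
  also have "\<dots> = exp (2 * real m / \<delta>)"
    using n_pos by (simp add: hit_rate_def flip: exp_of_nat_mult)
  finally have "N / 2 ^ L * (1 + hit_rate) ^ (m * n) \<le> N / 2 ^ L * exp (2 * real m / \<delta>)"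
    using N_pos by (intro mult_left_mono) auto
  moreover have "live_hits [] = 0" by (simp add: live_hits_def hits_def)
  ultimately have "\<Psi> [] \<le> N / 2 ^ L * exp (2 * real m / \<delta>)" by (simp add: \<Psi>_def)
  also have "\<dots> = real m * (real n * exp (2 * real m / \<delta>)) / 2 ^ L"
    by (simp add: N_def)
  also have "\<dots> \<le> real m * (\<delta> * 2 ^ L) / 2 ^ L"
    using L_ge by (intro divide_right_mono mult_left_mono) auto
  finally have "\<Psi> [] \<le> real m * \<delta>" by simp
  moreover have "rate * N = (1 + 20 * \<delta>) * real m"
    using n_pos by (simp add: rate_def N_def)
  ultimately show ?thesis
    by (simp add: \<Phi>_def guesses_def hits_def V_0 algebra_simps)
qed

lemma expected_score_le:
  assumes "G \<in> strategies n"
  shows "expected_score m n G \<le> real m + 21 * \<delta> * real m"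
proof -
  have "0 < real (card (decks m n))"
    using decks_nonempty finite_decks by (simp add: card_gt_0_iff)
  moreover have "(\<Sum>\<pi>\<in>decks m n. real (score G \<pi>)) \<le> real (card (decks m n)) * \<Phi> []"
    using sum_play_le[OF assms, of "[]" "m * n"] by (simp add: consistent_decks_Nil score_def)
  ultimately have "expected_score m n G \<le> \<Phi> []"
    by (simp add: expected_score_def pos_divide_le_eq mult.commute)
  with \<Phi>_Nil_le show ?thesis by linarith
qed

lemma P_plus_bounds: "real m \<le> P_plus m n" "P_plus m n \<le> real m + 21 * \<delta> * real m"
proof -
  let ?G = "\<lambda>_::(nat \<times> bool) list. 1::nat"
  have G: "?G \<in> strategies n" using n by (simp add: strategies_def)
  show "P_plus m n \<le> real m + 21 * \<delta> * real m"
    unfolding P_plus_def using G expected_score_le by (intro cSUP_least) auto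
  have "score ?G \<pi> = m" if "\<pi> \<in> decks m n" for \<pi>
    using that n by (simp add: score_def play_const decks_def)
  then have "expected_score m n ?G = real m"
    using decks_nonempty finite_decks by (simp add: expected_score_def)
  moreover have "expected_score m n ?G \<le> P_plus m n"
    unfolding P_plus_def using G expected_score_le
    by (intro cSUP_upper) (auto intro!: bdd_aboveI2)
  ultimately show "real m \<le> P_plus m n" by simp
qed

end

section \<open>Choice of parameters and the asymptotic bound\<close>

lemma eventually_guessing_bound:
  assumes "m \<ge> 2" "\<delta> > 0" "real m * (16 * \<delta> ^ 4) = 1"
  shows "\<exists>n0. \<forall>n\<ge>n0. \<exists>L. guessing_bound m n L \<delta>"
proof -
  \<comment> \<open>\<open>\<kappa> * n\<close> is half of the budget in \<open>L_le\<close>: one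
    half is for \<open>L\<close>, the other for \<open>m\<close>. As \<open>L\<close> grows linearly
    in n, \<open>2 ^ L\<close> eventually beats the linear left side of \<open>L_ge\<close>.\<close>
  define \<kappa> E where "\<kappa> = real m * \<delta> ^ 3 / 24" and "E = exp (2 * real m / \<delta>)"
  have \<kappa>: "\<kappa> > 0" and E: "E > 0" using assms by (auto simp: \<kappa>_def E_def)
  have "eventually (\<lambda>n::nat. real n * E \<le> \<delta> * 2 powr (\<kappa> * real n - 1)) at_top"
    using \<kappa> E assms(2) by real_asymp
  moreover have "eventually (\<lambda>n::nat. real m \<le> \<kappa> * real n) at_top"
    using \<kappa> by real_asymp
  moreover have "eventually (\<lambda>n::nat. n \<ge> 1) at_top" by (rule eventually_ge_at_top)
  ultimately have "eventually (\<lambda>n. \<exists>L. guessing_bound m n L \<delta>) at_top"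
  proof eventually_elim
    case (elim n)
    define L where "L = nat \<lfloor>\<kappa> * real n\<rfloor>"
    have 0: "0 \<le> \<kappa> * real n" using \<kappa> by simp
    have L1: "real L \<le> \<kappa> * real n" using 0 by (simp add: L_def)
    have L2: "\<kappa> * real n - 1 \<le> real L" using 0 unfolding L_def by linarith
    have "real (L + m) \<le> 2 * (\<kappa> * real n)" using L1 elim(2) by simp
    also have "\<dots> = real (m * n) * (\<delta> ^ 3 / 12)" by (simp add: \<kappa>_def)
    finally have 1: "real (L + m) \<le> real (m * n) * (\<delta> ^ 3 / 12)" .
    have "2 powr (\<kappa> * real n - 1) \<le> 2 powr real L" using L2 by simp
    then have "\<delta> * 2 powr (\<kappa> * real n - 1) \<le> \<delta> * 2 ^ L"
      using assms(2) by (simp add: powr_realpow)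
    with elim(1) have 2: "real n * exp (2 * real m / \<delta>) \<le> \<delta> * 2 ^ L" by (simp add: E_def)
    show ?case
      using assms elim(3) 1 2 by (intro exI[of _ L]) (unfold_locales, auto)
  qed
  then show ?thesis by (simp add: eventually_at_top_linorder)
qed

theorem theorem1p3:
  shows "\<exists>C>0. \<forall>m::nat. m \<ge> 2 \<longrightarrow> (\<exists>N. \<forall>n\<ge>N.
           \<bar>P_plus m n - real m\<bar> \<le> C * real m powr (3/4) * ln (real m) powr (1/4))"
proof (intro exI[of _ "21::real"] conjI allI impI)
  fix m :: nat assume m: "m \<ge> 2"
  define \<delta> where "\<delta> = real m powr (-1/4) / 2"
  have m0: "real m > 0" using m by simp
  have "\<delta> ^ 4 = (real m powr (-1/4)) ^ 4 / 16" by (simp add: \<delta>_def power_divide)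
  also have "(real m powr (-1/4)) ^ 4 = real m powr (-1)"
    using m0 by (simp flip: powr_realpow add: powr_powr)
  finally have \<delta>4: "real m * (16 * \<delta> ^ 4) = 1" using m0 by (simp add: powr_minus field_simps)
  have \<delta>: "\<delta> > 0" using m0 by (simp add: \<delta>_def)
  obtain n0 where n0: "\<And>n. n \<ge> n0 \<Longrightarrow> \<exists>L. guessing_bound m n L \<delta>"
    using eventually_guessing_bound[OF m \<delta> \<delta>4] by blast
  \<comment> \<open>The error \<open>21 * \<delta> * m\<close> equals 21/2 times m^(3/4), so it
    suffices that the logarithmic factor is at least 1/2; this follows from ln 2 \<ge> 1/2.\<close>
  have "exp (1/2) * exp (1/2) = exp (1::real)" by (simp flip: exp_add)
  then have "(exp (1/2::real))\<^sup>2 \<le> 2\<^sup>2" using exp_le by (simp add: power2_eq_square)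
  then have "exp (1/2::real) \<le> 2" by (rule power2_le_imp_le) simp
  then have "1/2 \<le> ln (2::real)" by (subst ln_ge_iff) auto
  also have "\<dots> \<le> ln (real m)" using m by simp
  finally have "(1/2) powr (1/4) \<le> ln (real m) powr (1/4)" by (intro powr_mono2) auto
  moreover have "(1/2::real) powr 1 \<le> (1/2) powr (1/4)" by (intro powr_mono') auto
  moreover have "(1/2::real) powr 1 = 1/2" by simp
  ultimately have ln: "1/2 \<le> ln (real m) powr (1/4)" by linarith
  have "\<delta> * real m = real m powr (3/4) / 2"
  proof -
    have "real m powr (-1/4) * real m powr 1 = real m powr (3/4)"
      unfolding powr_add[symmetric] by simp
    then show ?thesis using m0 by (simp add: \<delta>_def)
  qed
  then have "21 * \<delta> * real m = 21 * real m powr (3/4) * (1/2)" by simp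
  also have "\<dots> \<le> 21 * real m powr (3/4) * ln (real m) powr (1/4)"
    using ln by (intro mult_left_mono) auto
  finally have *: "21 * \<delta> * real m \<le> 21 * real m powr (3/4) * ln (real m) powr (1/4)" .
  have "\<bar>P_plus m n - real m\<bar> \<le> 21 * real m powr (3/4) * ln (real m) powr (1/4)" if le: "n \<ge> n0" for n
  proof -
    obtain L where "guessing_bound m n L \<delta>" using n0[OF le] by blast
    then show ?thesis using guessing_bound.P_plus_bounds[of m n L \<delta>] * by simp
  qed
  then show "\<exists>N. \<forall>n\<ge>N. \<bar>P_plus m n - real m\<bar>
      \<le> 21 * real m powr (3/4) * ln (real m) powr (1/4)" by blast
qed simp

end
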